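(* Let $a,b$ be integers with $3\le a\le b$, let $G=K_{a,b}$ be the complete bipartite graph, and for every integer $k\ge 0$ let $p_k=\ddot{\gamma}_P^k(G)$. Then for every $k\ge 0$, \[ p_{k+1}=\begin{cases} p_k+2 & \text{if } (k,p_k) \text{ satisfies the Jump Condition for } K_{a,b},\\ p_k+1 & \text{otherwise.}\end{cases} \]
   Context: All graphs are finite, simple, undirected, with nonempty vertex set. For $S\subseteq V(G)$ the power domination process is: (1) start with the observed set $N[S]$ (the union of closed neighborhoods of vertices of $S$); (2) while some observed vertex has exactly one unobserved neighbor $w$, add $w$ to the observed set. $S$ is a power dominating set if eventually all vertices are observed. For an integer $k\ge 0$, a multiset $S$ of vertices of $G$ is a $k$-PMU-defect-robust power dominating set ($k$-rPDS) if $|S|\ge k$ and for every submultiset $F$ of $S$ with $|F|=k$, the underlying set of $S\setminus F$ (multiset difference) contains a power dominating set of $G$. Cardinalities of multisets count multiplicity. $\ddot{\gamma}_P^k(G)$ is the minimum cardinality of a $k$-rPDS of $G$. Jump Condition: given integers $3\le a\le b$, $k\ge 0$ and $p_k=\ddot{\gamma}_P^k(K_{a,b})$, the pair $(k,p_k)$ satisfies the Jump Condition for $K_{a,b}$ if there exist nonnegative integers $q_a,r_a,q_b,r_b$ with $p_k=q_aa+r_a+q_bb+r_b$ such that (1) $q_aa+r_a+2q_b-1=k$; (2) $q_bb+r_b+2q_a-1=k$; (3) $r_a\le a-3$; (4) $r_b\le b-3$. *)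

theory Defs
  imports "Graph_Theory.Graph_Theory" "HOL-Library.Multiset"
begin

text \<open>
  A finite simple undirected graph is a symmetric digraph satisfying the locale \<open>graph\<close>;
  \<open>complete_bipartite_digraph\<close> (notation \<open>K\<^bsub>a,b\<^esub>\<close>) is a predicate on such graphs.
\<close>

definition nbrs :: "('a, 'b) pre_digraph \<Rightarrow> 'a \<Rightarrow> 'a set" where
  "nbrs G v = {w. v \<rightarrow>\<^bsub>G\<^esub> w}"

definition closed_nbrs :: "('a, 'b) pre_digraph \<Rightarrow> 'a \<Rightarrow> 'a set" where
  "closed_nbrs G v = insert v (nbrs G v)"

text \<open>
  \<open>pd_process G S X\<close>: some run of the process started from \<open>S\<close> has observed set \<open>X\<close> at some
  point. Runs are nondeterministic, but a step enabled at \<open>X\<close> is enabled at, or already performed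
  in, every larger observed set, so whether all vertices end up observed does not depend on the
  choices made.
\<close>
inductive pd_process :: "('a, 'b) pre_digraph \<Rightarrow> 'a set \<Rightarrow> 'a set \<Rightarrow> bool"
  for G :: "('a, 'b) pre_digraph" and S :: "'a set" where
  start: "pd_process G S (\<Union>v\<in>S. closed_nbrs G v)"
| step: "pd_process G S X \<Longrightarrow> v \<in> X \<Longrightarrow> nbrs G v - X = {w} \<Longrightarrow> pd_process G S (insert w X)"

definition power_dominating_set :: "('a, 'b) pre_digraph \<Rightarrow> 'a set \<Rightarrow> bool" where
  "power_dominating_set G S \<longleftrightarrow> S \<subseteq> verts G \<and> pd_process G S (verts G)"

definition rpds :: "('a, 'b) pre_digraph \<Rightarrow> nat \<Rightarrow> 'a multiset \<Rightarrow> bool" where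
  "rpds G k S \<longleftrightarrow> set_mset S \<subseteq> verts G \<and> k \<le> size S \<and>
     (\<forall>F. F \<subseteq># S \<and> size F = k \<longrightarrow>
        (\<exists>T \<subseteq> set_mset (S - F). power_dominating_set G T))"

text \<open>
  The minimum exists for every nonempty finite graph: \<open>k + 1\<close> copies of each vertex form a \<open>k\<close>-rPDS
  (lemmas below).
\<close>
definition rpd_number :: "('a, 'b) pre_digraph \<Rightarrow> nat \<Rightarrow> nat" where
  "rpd_number G k = (LEAST n. \<exists>S. rpds G k S \<and> size S = n)"

text \<open>The four conditions are stated over the integers, since subtraction on \<open>nat\<close> truncates.\<close>
definition jump_condition :: "nat \<Rightarrow> nat \<Rightarrow> nat \<Rightarrow> nat \<Rightarrow> bool" where
  "jump_condition a b k p \<longleftrightarrow>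
     (\<exists>qa ra qb rb :: nat.
        p = qa * a + ra + qb * b + rb \<and>
        int (qa * a + ra + 2 * qb) - 1 = int k \<and>
        int (qb * b + rb + 2 * qa) - 1 = int k \<and>
        int ra \<le> int a - 3 \<and>
        int rb \<le> int b - 3)"

lemma (in wf_digraph) power_dominating_set_verts: "power_dominating_set G (verts G)"
proof -
  have "(\<Union>v\<in>verts G. closed_nbrs G v) = verts G"
    using adj_in_verts by (auto simp: closed_nbrs_def nbrs_def)
  then show ?thesis
    using pd_process.start[of G "verts G"] by (simp add: power_dominating_set_def)
qed

lemma (in graph) rpds_exists:
  assumes "verts G \<noteq> {}"
  shows "\<exists>S. rpds G k S"
proof -
  define S where "S = (\<Sum>v\<in>verts G. replicate_mset (Suc k) v)"
  have cnt: "count S v = (if v \<in> verts G then Suc k else 0)" for v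
    by (auto simp: S_def count_sum sum.delta' simp del: replicate_mset_Suc)
  have sub: "verts G \<subseteq> set_mset (S - F)" if "size F = k" for F
  proof
    fix v assume "v \<in> verts G"
    moreover have "count F v \<le> k"
      using that count_le_size by metis
    ultimately show "v \<in># S - F"
      using cnt by (simp add: in_diff_count)
  qed
  obtain v where "v \<in> verts G"
    using assms by blast
  then have "k \<le> size S"
    using cnt[of v] count_le_size[of S v] by simp
  moreover have "set_mset S \<subseteq> verts G"
    using cnt by (metis count_eq_zero_iff subsetI)
  ultimately have "rpds G k S"
    unfolding rpds_def using sub power_dominating_set_verts by blast
  then show ?thesis ..
qed

lemma (in graph) rpd_number_attained:
  assumes "verts G \<noteq> {}"
  shows "\<exists>S. rpds G k S \<and> size S = rpd_number G k"
  unfolding rpd_number_def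
  by (rule LeastI_ex) (use rpds_exists[OF assms] in blast)

end

theory Submission
  imports Defs
begin

text \<open>
  A vertex set of \<open>K\<^bsub>a,b\<^esub>\<close> fails to be power dominating iff it lies in one part and misses two
  vertices of that part. Hence a multiset with \<open>x\<close> elements in the \<open>a\<close>-part and \<open>y\<close> in the \<open>b\<close>-part
  is robust against \<open>k\<close> deletions iff \<open>k\<close> is less than \<open>y\<close> plus the two smallest multiplicities in
  the \<open>a\<close>-part, and likewise with the parts exchanged. The best choice of multiplicities is the
  balanced one, where the two smallest add up to \<open>f\<^sub>a x = \<lfloor>x/a\<rfloor> + \<lfloor>(x+1)/a\<rfloor>\<close>. So \<open>p\<^sub>k\<close> is the least
  \<open>x + y\<close> such that \<open>y + f\<^sub>a x\<close> and \<open>x + f\<^sub>b y\<close> both exceed \<open>k\<close>. As \<open>f\<^sub>a\<close> grows by at most 1 per step,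
  \<open>p\<close> grows by 1 or 2, and it grows by 2 exactly if at an optimal \<open>(x, y)\<close> both quantities
  equal \<open>k + 1\<close> and neither \<open>f\<^sub>a\<close> nor \<open>f\<^sub>b\<close> increases at the next step; this is the Jump Condition.
\<close>

section \<open>Balanced distributions\<close>

definition balanced_pair :: "nat \<Rightarrow> nat \<Rightarrow> nat" where
  "balanced_pair a x = x div a + (x + 1) div a"

text \<open>Hermite's identity at \<open>x / a\<close>: raising \<open>x\<close> by one removes
  \<open>x div a\<close> from the sum and adds \<open>(x + a) div a\<close>, one more.\<close>

lemma sum_div_shift:
  assumes "0 < (a::nat)"
  shows "(\<Sum>i<a. (x + i) div a) = x"
proof (induction x)
  case 0
  then show ?case by simp
next
  case (Suc x)
  have "(\<Sum>i<a. (Suc x + i) div a) + x div a = (\<Sum>i<Suc a. (x + i) div a)"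
    by (subst sum.lessThan_Suc_shift) simp
  also have "\<dots> = x + (x div a + 1)"
    using Suc assms by simp
  finally show ?case by simp
qed

text \<open>An even distribution of \<open>q * a + r\<close> over \<open>a\<close> places has
  \<open>a - r\<close> entries \<open>q\<close> and \<open>r\<close> entries \<open>q + 1\<close>.
  Two entries \<open>q\<close> exist unless \<open>r = a - 1\<close>.\<close>

lemma balanced_pair_decomp:
  assumes "r < a"
  shows "balanced_pair a (q * a + r) = 2 * q + (if r + 1 = a then 1 else 0)"
proof (cases "r + 1 = a")
  case True
  then have "q * a + r + 1 = (q + 1) * a" by simp
  then have "(q * a + r + 1) div a = q + 1"
    using assms by (metis nonzero_mult_div_cancel_right not_less_zero)
  then show ?thesis
    using True assms by (simp add: balanced_pair_def)
next
  case False
  then have "(q * a + (r + 1)) div a = q"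
    using assms by (intro div_nat_eqI) auto
  then show ?thesis
    using False assms by (simp add: balanced_pair_def)
qed

text \<open>One more unit uses up one of the \<open>a - r\<close> smallest entries, so the two
  smallest keep their sum iff at least three were there. This is the source of the bounds on
  \<open>ra\<close> and \<open>rb\<close> in the Jump Condition.\<close>

lemma balanced_pair_Suc:
  assumes "3 \<le> a" "r < a"
  shows "balanced_pair a (Suc (q * a + r)) =
    balanced_pair a (q * a + r) + (if r + 3 \<le> a then 0 else 1)"
proof (cases "r + 1 = a")
  case True
  then have "Suc (q * a + r) = (q + 1) * a + 0" by simp
  then have "balanced_pair a (Suc (q * a + r)) = balanced_pair a ((q + 1) * a + 0)"
    by (rule arg_cong)
  also have "\<dots> = 2 * (q + 1)"
    using assms by (subst balanced_pair_decomp) auto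
  finally have "balanced_pair a (Suc (q * a + r)) = 2 * (q + 1)" .
  then show ?thesis
    using True assms balanced_pair_decomp[of r a q] by simp
next
  case False
  then show ?thesis
    using assms balanced_pair_decomp[of "r + 1" a q] balanced_pair_decomp[of r a q] by auto
qed

lemma balanced_pair_Suc_le:
  assumes "3 \<le> a"
  shows "balanced_pair a (Suc x) \<le> balanced_pair a x + 1"
  using balanced_pair_Suc[OF assms, of "x mod a" "x div a"] assms by simp

lemma balanced_pair_mono: "x \<le> y \<Longrightarrow> balanced_pair a x \<le> balanced_pair a y"
  unfolding balanced_pair_def by (intro add_mono div_le_mono) auto

lemma balanced_pair_add_le:
  assumes "3 \<le> a"
  shows "balanced_pair a (x + d) \<le> balanced_pair a x + d"
proof (induction d)
  case (Suc d)
  then show ?case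
    using balanced_pair_Suc_le[OF assms, of "x + d"] by simp
qed simp

lemma balanced_pair_le:
  assumes "3 \<le> a"
  shows "balanced_pair a x \<le> x"
  using balanced_pair_add_le[OF assms, of 0 x] assms by (simp add: balanced_pair_def)

lemma ex_balanced:
  assumes "finite U" "2 \<le> card U"
  shows "\<exists>c. (\<Sum>u\<in>U. c u) = x \<and>
    (\<forall>u\<in>U. \<forall>v\<in>U. u \<noteq> v \<longrightarrow> balanced_pair (card U) x \<le> c u + c v)"
proof -
  let ?a = "card U"
  obtain h where h: "bij_betw h U {..<?a}"
    using ex_bij_betw_finite_nat[OF assms(1)] by (auto simp: atLeast0LessThan)
  define c where "c u = (x + h u) div ?a" for u
  have "(\<Sum>u\<in>U. c u) = (\<Sum>i<?a. (x + i) div ?a)"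
    unfolding c_def by (rule sum.reindex_bij_betw[OF h])
  also have "\<dots> = x"
    using assms by (intro sum_div_shift) simp
  finally have "(\<Sum>u\<in>U. c u) = x" .
  \<comment> \<open>The larger index is at least 1, so its share is at least
    \<open>(x + 1) div ?a\<close>.\<close>
  moreover have "balanced_pair ?a x \<le> c u + c v" if "h u < h v" for u v
    unfolding balanced_pair_def c_def using that by (intro add_mono div_le_mono) auto
  moreover have "h u < h v \<or> h v < h u" if "u \<in> U" "v \<in> U" "u \<noteq> v" for u v
    using h that by (metis bij_betw_inv_into_left nat_neq_iff)
  ultimately show ?thesis
    by (intro exI[of _ c]) (metis add.commute)
qed

text \<open>Let \<open>s\<close> be the sum of the two smallest entries. The other entries are at
  least the second smallest, hence at least \<open>s / 2\<close> rounded up. Summing all entries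
  bounds the lower half of \<open>s\<close> by \<open>x div a\<close> and the upper half by
  \<open>(x + 1) div a\<close>, where \<open>x\<close> is the total and \<open>a\<close> the number
  of entries.\<close>

lemma ex_pair_le_balanced:
  fixes c :: "'a \<Rightarrow> nat"
  assumes "finite U" "2 \<le> card U"
  shows "\<exists>u\<in>U. \<exists>v\<in>U. u \<noteq> v \<and> c u + c v \<le> balanced_pair (card U) (\<Sum>u\<in>U. c u)"
proof -
  let ?a = "card U" and ?x = "\<Sum>u\<in>U. c u"
  have "U \<noteq> {}" using assms by auto
  then obtain u where u: "u \<in> U" "\<And>w. w \<in> U \<Longrightarrow> c u \<le> c w"
    using arg_min_if_finite[OF assms(1), of c] by (meson leI)
  have card: "card (U - {u}) = ?a - 1" using u assms by simp
  then have "U - {u} \<noteq> {}" using assms by fastforce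
  then obtain v where v: "v \<in> U - {u}" "\<And>w. w \<in> U - {u} \<Longrightarrow> c v \<le> c w"
    using arg_min_if_finite[of "U - {u}" c] assms by (meson finite_Diff leI)
  obtain d where d: "?a = d + 2" using assms(2) by (metis add.commute le_Suc_ex)
  let ?s = "c u + c v"
  have "?x = c u + (\<Sum>w\<in>U - {u}. c w)"
    using u assms by (simp add: sum.remove)
  moreover have "(\<Sum>w\<in>U - {u}. c v) \<le> (\<Sum>w\<in>U - {u}. c w)"
    by (rule sum_mono) (use v in auto)
  ultimately have "c u + (?a - 1) * c v \<le> ?x"
    using card by (metis add_le_cancel_left of_nat_id sum_constant)
  then have x: "?s + d * c v \<le> ?x"
    by (simp add: d)
  have "(?s + 1) div 2 \<le> c v" using u(2)[of v] v by auto
  then have "d * ((?s + 1) div 2) \<le> d * c v"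
    by simp
  with x have x': "?s + d * ((?s + 1) div 2) \<le> ?x" by linarith
  define t where "t = ?s div 2"
  have "t * ?a \<le> ?x \<and> ((?s + 1) div 2) * ?a \<le> ?x + 1"
  proof (cases "even ?s")
    case True
    then have "?s = 2 * t" "(?s + 1) div 2 = t" by (auto simp: t_def)
    then show ?thesis using x' d by (simp add: algebra_simps)
  next
    case False
    then have "?s = 2 * t + 1" "(?s + 1) div 2 = t + 1" by (auto simp: t_def elim: oddE)
    then show ?thesis using x' d by (simp add: algebra_simps)
  qed
  then have "t \<le> ?x div ?a" "(?s + 1) div 2 \<le> (?x + 1) div ?a"
    using d by (simp_all add: less_eq_div_iff_mult_less_eq)
  moreover have "?s = t + (?s + 1) div 2" unfolding t_def by presburger
  ultimately have "?s \<le> balanced_pair ?a ?x" unfolding balanced_pair_def by linarith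
  then show ?thesis using u(1) v(1) by (intro bexI[of _ u] bexI[of _ v]) auto
qed

section \<open>Robust power domination in complete bipartite graphs\<close>

text \<open>Pads a deletion of at most \<open>k\<close> elements to exactly \<open>k\<close>, the
  size that \<open>rpds\<close> quantifies over.\<close>

lemma mset_extend_submset:
  assumes "F0 \<subseteq># S" "size F0 \<le> k" "k \<le> size S"
  shows "\<exists>F. F0 \<subseteq># F \<and> F \<subseteq># S \<and> size F = k"
  using assms(2,3)
proof (induction k)
  case 0
  then show ?case using assms(1) by auto
next
  case (Suc k)
  show ?case
  proof (cases "size F0 = Suc k")
    case True
    then show ?thesis using assms(1) by auto
  next
    case False
    then obtain F where F: "F0 \<subseteq># F" "F \<subseteq># S" "size F = k" using Suc by auto
    obtain D where D: "S = F + D"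
      using F(2) by (metis mset_subset_eq_exists_conv)
    then obtain z D' where "D = add_mset z D'"
      using F(3) Suc.prems by (metis Suc_n_not_le_n add.right_neutral multiset_cases)
    then have "add_mset z F \<subseteq># S"
      using D by simp
    then show ?thesis using F
      by (intro exI[of _ "add_mset z F"]) (auto intro: subset_mset.order_trans)
  qed
qed

definition misses_two :: "'a set \<Rightarrow> 'a set \<Rightarrow> bool" where
  "misses_two X T \<longleftrightarrow> T \<subseteq> X \<and> (\<exists>u\<in>X - T. \<exists>u'\<in>X - T. u \<noteq> u')"

locale bipartite_parts =
  fixes G :: "('v, 'e) pre_digraph" and U V :: "'v set"
  assumes verts_eq: "verts G = U \<union> V"
    and disj: "U \<inter> V = {}"
    and ends: "arcs_ends G = U \<times> V \<union> V \<times> U"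
    and fin: "finite U" "finite V"
    and card_U: "3 \<le> card U"
    and card_V: "3 \<le> card V"
begin

text \<open>The assumptions are symmetric in the parts, so each fact about \<open>U\<close> yields
  its mirror image about \<open>V\<close>.\<close>

lemma swap: "bipartite_parts G V U"
  using verts_eq disj ends fin card_U card_V by unfold_locales auto

section \<open>Power dominating sets of a complete bipartite graph\<close>

lemma nbrs_U: "u \<in> U \<Longrightarrow> nbrs G u = V"
  using ends disj by (auto simp: nbrs_def)

lemma nbrs_V: "v \<in> V \<Longrightarrow> nbrs G v = U"
  using ends disj by (auto simp: nbrs_def)

text \<open>Invariant: \<open>u\<close> and \<open>u'\<close> both stay unobserved. Every vertex of
  \<open>V\<close> is adjacent to both, so it never has exactly one unobserved neighbor, and no
  other vertex has a neighbor in \<open>U\<close>.\<close>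

lemma not_pds_if_two_missing:
  assumes "T \<subseteq> U" "u \<in> U - T" "u' \<in> U - T" "u \<noteq> u'"
  shows "\<not> power_dominating_set G T"
proof -
  have "u \<notin> X \<and> u' \<notin> X" if "pd_process G T X" for X
    using that
  proof induction
    case start
    then show ?case
      using assms disj by (auto simp: closed_nbrs_def nbrs_U subset_iff)
  next
    case (step X v w)
    show ?case
    proof (cases "v \<in> V")
      case True
      then have "u \<in> {w}" "u' \<in> {w}"
        using step.IH step.hyps(3) assms(2,3) nbrs_V by auto
      then show ?thesis using assms(4) by simp
    next
      case False
      then have "nbrs G v \<inter> U = {}"
        using ends disj by (auto simp: nbrs_def)
      then have "w \<notin> U" using step.hyps(3) by blast
      then show ?thesis using step.IH assms(2,3) by auto
    qed
  qed
  from this[of "verts G"] show ?thesis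
    using assms(2) by (auto simp: power_dominating_set_def verts_eq)
qed

text \<open>The start observes \<open>T\<close> and all of \<open>V\<close>; then any vertex of
  \<open>V\<close> forces the possible last vertex of \<open>U\<close>.\<close>

lemma pds_if_one_missing:
  assumes "T \<subseteq> U" "\<And>u u'. u \<in> U - T \<Longrightarrow> u' \<in> U - T \<Longrightarrow> u = u'"
  shows "power_dominating_set G T"
proof -
  have "T \<noteq> {}"
  proof
    assume "T = {}"
    then have "card U \<le> 1"
      using assms(2) fin by (auto simp: card_le_Suc0_iff_eq)
    then show False using card_U by simp
  qed
  then have init: "(\<Union>v\<in>T. closed_nbrs G v) = T \<union> V"
    using assms(1) by (auto simp: closed_nbrs_def nbrs_U subset_iff)
  have start: "pd_process G T (T \<union> V)"
    using pd_process.start[of G T] by (simp add: init)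
  have "pd_process G T (U \<union> V)"
  proof (cases "U \<subseteq> T")
    case True
    then show ?thesis using start assms(1) by (metis subset_antisym)
  next
    case False
    then obtain w where w: "w \<in> U" "w \<notin> T" by blast
    then have "insert w T = U" using assms by blast
    moreover obtain v where v: "v \<in> V" using card_V by fastforce
    moreover have "nbrs G v - (T \<union> V) = {w}"
      using w assms disj nbrs_V[OF v] by blast
    ultimately show ?thesis
      using pd_process.step[OF start, of v w] by (metis Un_insert_left UnI2)
  qed
  then show ?thesis
    using assms(1) by (simp add: power_dominating_set_def verts_eq le_supI1)
qed

lemma pds_if_both_parts:
  assumes "T \<subseteq> U \<union> V" "u \<in> T \<inter> U" "v \<in> T \<inter> V"
  shows "power_dominating_set G T"
proof -
  have "(\<Union>v\<in>T. closed_nbrs G v) = U \<union> V"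
  proof
    show "(\<Union>v\<in>T. closed_nbrs G v) \<subseteq> U \<union> V"
      using assms(1) by (auto simp: closed_nbrs_def dest!: subsetD[of T] simp: nbrs_U nbrs_V)
    show "U \<union> V \<subseteq> (\<Union>v\<in>T. closed_nbrs G v)"
      using assms nbrs_U[of u] nbrs_V[of v] by (auto simp: closed_nbrs_def)
  qed
  then show ?thesis
    using pd_process.start[of G T] assms by (simp add: power_dominating_set_def verts_eq)
qed

lemma pds_iff:
  assumes "T \<subseteq> U \<union> V"
  shows "power_dominating_set G T \<longleftrightarrow> \<not> misses_two U T \<and> \<not> misses_two V T"
proof -
  interpret VU: bipartite_parts G V U by (rule swap)
  have "(\<exists>u v. u \<in> T \<inter> U \<and> v \<in> T \<inter> V) \<or> T \<subseteq> U \<or> T \<subseteq> V" using assms by blast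
  then consider u v where "u \<in> T \<inter> U" "v \<in> T \<inter> V" | "misses_two U T" | "misses_two V T"
    | "T \<subseteq> U" "\<not> misses_two U T" | "T \<subseteq> V" "\<not> misses_two V T"
    by blast
  then show ?thesis
  proof cases
    case 1
    then show ?thesis
      using pds_if_both_parts[OF assms] disj unfolding misses_two_def by blast
  next
    case 2
    then show ?thesis
      using not_pds_if_two_missing unfolding misses_two_def by blast
  next
    case 3
    then show ?thesis
      using VU.not_pds_if_two_missing unfolding misses_two_def by blast
  next
    case 4
    then have "power_dominating_set G T"
      using pds_if_one_missing unfolding misses_two_def by blast
    \<comment> \<open>\<open>misses_two V T\<close> would contradict the power domination just
      shown.\<close>
    then show ?thesis
      using 4 VU.not_pds_if_two_missing unfolding misses_two_def by blast
  next
    case 5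
    then have "power_dominating_set G T"
      using VU.pds_if_one_missing unfolding misses_two_def by blast
    then show ?thesis
      using 5 not_pds_if_two_missing unfolding misses_two_def by blast
  qed
qed

text \<open>Lets "contains a power dominating set" in \<open>rpds\<close> be read as "is a power
  dominating set".\<close>

lemma pds_mono:
  assumes "power_dominating_set G T" "T \<subseteq> T'" "T' \<subseteq> U \<union> V"
  shows "power_dominating_set G T'"
proof -
  have "misses_two X T" if "misses_two X T'" for X
    using that assms(2) unfolding misses_two_def by blast
  then show ?thesis using assms pds_iff[of T] pds_iff[of T'] by blast
qed

text \<open>The cheapest deletion that leaves only vertices of \<open>U\<close> and misses
  \<open>u\<close> and \<open>u'\<close> removes exactly the copies of \<open>u\<close>,
  \<open>u'\<close> and all vertices of \<open>V\<close>. Padding it to size \<open>k\<close> only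
  shrinks what survives.\<close>

lemma ex_misses_two_iff:
  assumes S: "set_mset S \<subseteq> U \<union> V" "k \<le> size S"
  shows "(\<exists>F. F \<subseteq># S \<and> size F = k \<and> misses_two U (set_mset (S - F))) \<longleftrightarrow>
    (\<exists>u\<in>U. \<exists>u'\<in>U. u \<noteq> u' \<and> (\<Sum>v\<in>V. count S v) + count S u + count S u' \<le> k)"
    (is "?L \<longleftrightarrow> ?R")
proof -
  have cost: "(\<Sum>z\<in>insert u (insert u' V). count S z) =
      (\<Sum>v\<in>V. count S v) + count S u + count S u'"
    if "u \<in> U" "u' \<in> U" "u \<noteq> u'" for u u'
  proof -
    have "u \<notin> V" "u' \<notin> V" using that disj by auto
    then show ?thesis using that fin by simp
  qed
  have hit: "(\<Sum>z\<in>insert u (insert u' V). count S z) \<le> size F"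
    if "F \<subseteq># S" "insert u (insert u' V) \<inter> set_mset (S - F) = {}" for F u u'
  proof -
    let ?W = "insert u (insert u' V)"
    have "count S z \<le> count F z" if "z \<in> ?W" for z
      using \<open>?W \<inter> _ = {}\<close> that by (metis disjoint_iff in_diff_count leI)
    then have "(\<Sum>z\<in>?W. count S z) \<le> (\<Sum>z\<in>?W. count F z)" by (rule sum_mono)
    \<comment> \<open>Enlarging the index set to cover the support of \<open>F\<close> makes the sum
      equal to \<open>size F\<close>.\<close>
    also have "\<dots> \<le> (\<Sum>z\<in>?W \<union> set_mset F. count F z)"
      using fin by (intro sum_mono2) auto
    also have "\<dots> = size F"
      unfolding size_multiset_overloaded_eq using fin
      by (intro sum.mono_neutral_right) (auto simp: not_in_iff)
    finally show ?thesis .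
  qed
  show ?thesis
  proof
    assume ?L
    then obtain F u u' where F: "F \<subseteq># S" "size F = k" "set_mset (S - F) \<subseteq> U"
      and u: "u \<in> U - set_mset (S - F)" "u' \<in> U - set_mset (S - F)" "u \<noteq> u'"
      unfolding misses_two_def by blast
    have "insert u (insert u' V) \<inter> set_mset (S - F) = {}"
      using u F(3) disj by blast
    then have "(\<Sum>v\<in>V. count S v) + count S u + count S u' \<le> k"
      using hit[OF F(1)] cost[of u u'] u F(2) by (metis DiffD1)
    then show ?R using u by blast
  next
    assume ?R
    then obtain u u' where u: "u \<in> U" "u' \<in> U" "u \<noteq> u'"
      and le: "(\<Sum>v\<in>V. count S v) + count S u + count S u' \<le> k" by blast
    let ?W = "insert u (insert u' V)"
    let ?F0 = "filter_mset (\<lambda>z. z \<in> ?W) S"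
    have "size ?F0 = (\<Sum>z\<in>?W. count ?F0 z)"
      unfolding size_multiset_overloaded_eq using fin
      by (intro sum.mono_neutral_left) (auto simp: not_in_iff)
    also have "\<dots> = (\<Sum>z\<in>?W. count S z)" by (intro sum.cong) auto
    finally have "size ?F0 \<le> k" using cost[OF u] le by simp
    then obtain F where F: "?F0 \<subseteq># F" "F \<subseteq># S" "size F = k"
      using mset_extend_submset[of ?F0 S k] S(2) by auto
    have "z \<notin># S - F" if "z \<in> ?W" for z
      using mset_subset_eq_count[OF F(1), of z] that by (auto simp: in_diff_count)
    moreover have "set_mset (S - F) \<subseteq> U \<union> V"
      using S(1) by (meson in_diffD subset_iff)
    ultimately have "misses_two U (set_mset (S - F))"
      unfolding misses_two_def using u by blast
    then show ?L using F by blast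
  qed
qed

lemma rpds_iff:
  "rpds G k S \<longleftrightarrow> set_mset S \<subseteq> U \<union> V \<and> k \<le> size S \<and>
    (\<forall>u\<in>U. \<forall>u'\<in>U. u \<noteq> u' \<longrightarrow> k < (\<Sum>v\<in>V. count S v) + count S u + count S u') \<and>
    (\<forall>v\<in>V. \<forall>v'\<in>V. v \<noteq> v' \<longrightarrow> k < (\<Sum>u\<in>U. count S u) + count S v + count S v')"
proof (cases "set_mset S \<subseteq> U \<union> V \<and> k \<le> size S")
  case True
  interpret VU: bipartite_parts G V U by (rule swap)
  have sub: "set_mset (S - F) \<subseteq> U \<union> V" for F
    using True by (meson in_diffD subset_iff)
  have "(\<exists>T\<subseteq>set_mset (S - F). power_dominating_set G T) \<longleftrightarrow>
      power_dominating_set G (set_mset (S - F))" for F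
    using pds_mono[OF _ _ sub] by blast
  then have "rpds G k S \<longleftrightarrow>
      (\<forall>F. F \<subseteq># S \<and> size F = k \<longrightarrow> power_dominating_set G (set_mset (S - F)))"
    unfolding rpds_def verts_eq using True by simp
  also have "\<dots> \<longleftrightarrow>
      \<not> (\<exists>F. F \<subseteq># S \<and> size F = k \<and> misses_two U (set_mset (S - F))) \<and>
      \<not> (\<exists>F. F \<subseteq># S \<and> size F = k \<and> misses_two V (set_mset (S - F)))"
    using pds_iff[OF sub] by blast
  also have "\<dots> \<longleftrightarrow>
      \<not> (\<exists>u\<in>U. \<exists>u'\<in>U. u \<noteq> u' \<and> (\<Sum>v\<in>V. count S v) + count S u + count S u' \<le> k) \<and>
      \<not> (\<exists>v\<in>V. \<exists>v'\<in>V. v \<noteq> v' \<and> (\<Sum>u\<in>U. count S u) + count S v + count S v' \<le> k)"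
    \<comment> \<open>The mirrored lemma speaks of \<open>V \<union> U\<close>, which is reordered
      to match.\<close>
    using True by (simp add: ex_misses_two_iff VU.ex_misses_two_iff[unfolded Un_commute[of V]])
  finally show ?thesis
    using True unfolding not_le[symmetric] by blast
next
  case False
  then show ?thesis by (auto simp: rpds_def verts_eq)
qed

section \<open>Reduction to the numbers of elements in the two parts\<close>

lemma size_eq_sum_parts:
  assumes "set_mset S \<subseteq> U \<union> V"
  shows "size S = (\<Sum>u\<in>U. count S u) + (\<Sum>v\<in>V. count S v)"
proof -
  have "size S = (\<Sum>z\<in>U \<union> V. count S z)"
    unfolding size_multiset_overloaded_eq using fin assms
    by (intro sum.mono_neutral_left) (auto simp: not_in_iff)
  then show ?thesis
    using fin disj by (simp add: sum.union_disjoint)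
qed

text \<open>Here \<open>x\<close> and \<open>y\<close> count the elements in \<open>U\<close> and
  \<open>V\<close>. Some pair in each part is at most the balanced value, which gives necessity;
  spreading evenly in both parts gives sufficiency.\<close>

lemma ex_rpds_iff:
  "(\<exists>S. rpds G k S \<and> size S = n) \<longleftrightarrow>
    (\<exists>x y. x + y = n \<and> k < y + balanced_pair (card U) x \<and> k < x + balanced_pair (card V) y)"
    (is "?L \<longleftrightarrow> ?R")
proof
  assume ?L
  then obtain S where S: "rpds G k S" "size S = n" by blast
  let ?x = "\<Sum>u\<in>U. count S u" and ?y = "\<Sum>v\<in>V. count S v"
  have n: "?x + ?y = n"
    using S size_eq_sum_parts[of S] by (simp add: rpds_iff)
  obtain u u' where u: "u \<in> U" "u' \<in> U" "u \<noteq> u'"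
    "count S u + count S u' \<le> balanced_pair (card U) ?x"
    using ex_pair_le_balanced[of U "count S"] fin card_U by auto
  obtain v v' where v: "v \<in> V" "v' \<in> V" "v \<noteq> v'"
    "count S v + count S v' \<le> balanced_pair (card V) ?y"
    using ex_pair_le_balanced[of V "count S"] fin card_V by auto
  have "k < ?y + count S u + count S u'" "k < ?x + count S v + count S v'"
    using S(1) u v by (auto simp: rpds_iff)
  then show ?R using n u(4) v(4)
    by (intro exI[of _ ?x] exI[of _ ?y]) auto
next
  assume ?R
  then obtain x y where xy: "x + y = n" "k < y + balanced_pair (card U) x"
    "k < x + balanced_pair (card V) y" by blast
  obtain c where c: "(\<Sum>u\<in>U. c u) = x"
    "\<And>u v. u \<in> U \<Longrightarrow> v \<in> U \<Longrightarrow> u \<noteq> v \<Longrightarrow> balanced_pair (card U) x \<le> c u + c v"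
    using ex_balanced[OF fin(1), of x] card_U by auto
  obtain d where d: "(\<Sum>u\<in>V. d u) = y"
    "\<And>u v. u \<in> V \<Longrightarrow> v \<in> V \<Longrightarrow> u \<noteq> v \<Longrightarrow> balanced_pair (card V) y \<le> d u + d v"
    using ex_balanced[OF fin(2), of y] card_V by auto
  define e where "e z = (if z \<in> U then c z else d z)" for z
  define S where "S = (\<Sum>z\<in>U \<union> V. replicate_mset (e z) z)"
  have cnt: "count S z = (if z \<in> U \<union> V then e z else 0)" for z
    using fin by (auto simp: S_def count_sum sum.delta')
  have cU: "count S u = c u" if "u \<in> U" for u
    using that by (simp add: cnt e_def)
  have dV: "count S v = d v" if "v \<in> V" for v
    using that disj by (auto simp: cnt e_def)
  have sumU: "(\<Sum>u\<in>U. count S u) = x"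
    using c(1) by (simp add: cU)
  have sumV: "(\<Sum>v\<in>V. count S v) = y"
    using d(1) by (simp add: dV)
  have supp: "set_mset S \<subseteq> U \<union> V"
    using cnt by (metis count_eq_zero_iff subsetI)
  then have size: "size S = n"
    using xy(1) by (simp add: size_eq_sum_parts sumU sumV)
  note supp
  \<comment> \<open>From \<open>k < y + balanced_pair (card U) x\<close> and
    \<open>balanced_pair (card U) x <= x\<close>.\<close>
  moreover have "k \<le> size S"
    using xy balanced_pair_le[OF card_U, of x] size by simp
  moreover have "k < (\<Sum>v\<in>V. count S v) + count S u + count S u'"
    if "u \<in> U" "u' \<in> U" "u \<noteq> u'" for u u'
    using c(2)[OF that] xy(2) that cU by (simp add: sumV)
  moreover have "k < (\<Sum>u\<in>U. count S u) + count S v + count S v'"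
    if "v \<in> V" "v' \<in> V" "v \<noteq> v'" for v v'
    using d(2)[OF that] xy(3) that dV by (simp add: sumU)
  ultimately have "rpds G k S" unfolding rpds_iff by blast
  then show ?L using size by blast
qed

end

section \<open>The jump\<close>

definition robust_split :: "nat \<Rightarrow> nat \<Rightarrow> nat \<Rightarrow> nat \<Rightarrow> nat \<Rightarrow> bool" where
  "robust_split a b k x y \<longleftrightarrow> k < y + balanced_pair a x \<and> k < x + balanced_pair b y"

text \<open>Removing one element lowers each of the two quantities by at most one. Hence the minimum
  strictly increases with \<open>k\<close>.\<close>

lemma robust_split_Suc_pred:
  assumes "3 \<le> a" "3 \<le> b" "robust_split a b (Suc k) x y"
  shows "\<exists>x' y'. x + y = Suc (x' + y') \<and> robust_split a b k x' y'"
proof (cases x)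
  case (Suc x')
  then show ?thesis
    using assms balanced_pair_Suc_le[of a x']
    by (intro exI[of _ x'] exI[of _ y]) (auto simp: robust_split_def)
next
  \<comment> \<open>With nothing to remove on the first side, the element comes from the second,
    which is nonempty.\<close>
  case 0
  then have "0 < y"
    using assms balanced_pair_le[of b y] by (simp add: robust_split_def)
  then obtain y' where "y = Suc y'" by (cases y) auto
  then show ?thesis
    using assms balanced_pair_Suc_le[of b y']
    by (intro exI[of _ x] exI[of _ y']) (auto simp: robust_split_def)
qed

lemma robust_split_Suc_Suc:
  assumes "robust_split a b k x y"
  shows "robust_split a b (Suc k) (Suc x) (Suc y)"
  using assms balanced_pair_mono[of x "Suc x" a] balanced_pair_mono[of y "Suc y" b]
  by (simp add: robust_split_def)

text \<open>The jump data give a split \<open>(X, Y)\<close> of \<open>p\<close> with both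
  quantities equal to \<open>k + 1\<close>. A split of \<open>p + 1\<close> has the form
  \<open>(X + 1 + d, Y - d)\<close> or \<open>(X - d, Y + 1 + d)\<close>. The first extra unit gains
  nothing in the balanced value and the other \<open>d\<close> gain at most \<open>d\<close>, offset
  by the loss of \<open>d\<close> on the other side.\<close>

lemma no_robust_split_if_jump:
  assumes "3 \<le> a" "3 \<le> b" "jump_condition a b k p" "x + y = Suc p"
  shows "\<not> robust_split a b (Suc k) x y"
proof -
  obtain qa ra qb rb where q: "p = qa * a + ra + (qb * b + rb)"
    "qa * a + ra + 2 * qb = Suc k" "qb * b + rb + 2 * qa = Suc k"
    "ra + 3 \<le> a" "rb + 3 \<le> b"
  proof -
    obtain qa ra qb rb where "p = qa * a + ra + qb * b + rb"
      "int (qa * a + ra + 2 * qb) - 1 = int k" "int (qb * b + rb + 2 * qa) - 1 = int k"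
      "int ra \<le> int a - 3" "int rb \<le> int b - 3"
      using assms(3) unfolding jump_condition_def by blast
    then show thesis by (intro that[of qa ra qb rb]) linarith+
  qed
  let ?x = "qa * a + ra" and ?y = "qb * b + rb"
  have fa: "balanced_pair a (Suc ?x) = 2 * qa"
    using q balanced_pair_Suc[of a ra qa] balanced_pair_decomp[of ra a qa] assms by auto
  have fb: "balanced_pair b (Suc ?y) = 2 * qb"
    using q balanced_pair_Suc[of b rb qb] balanced_pair_decomp[of rb b qb] assms by auto
  show ?thesis
  proof (cases "?x < x")
    case True
    then obtain d where d: "x = Suc ?x + d" by (metis Suc_leI le_Suc_ex)
    have "y + balanced_pair a x \<le> y + (2 * qa + d)"
      using balanced_pair_add_le[OF assms(1), of "Suc ?x" d] fa d by simp
    also have "\<dots> = Suc k" using q d assms(4) by linarith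
    finally show ?thesis by (simp add: robust_split_def)
  next
    case False
    then have "Suc ?y \<le> y" using assms(4) q by linarith
    then obtain d where d: "y = Suc ?y + d" by (metis le_Suc_ex)
    have "x + balanced_pair b y \<le> x + (2 * qb + d)"
      using balanced_pair_add_le[OF assms(2), of "Suc ?y" d] fb d by simp
    also have "\<dots> = Suc k" using q d assms(4) by linarith
    finally show ?thesis by (simp add: robust_split_def)
  qed
qed

lemma ex_robust_split_if_not_jump:
  assumes "3 \<le> a" "3 \<le> b" "robust_split a b k x y" "\<not> jump_condition a b k (x + y)"
  shows "\<exists>x' y'. x' + y' = Suc (x + y) \<and> robust_split a b (Suc k) x' y'"
proof (rule ccontr)
  assume "\<not> ?thesis"
  then have no: "\<not> robust_split a b (Suc k) (Suc x) y" "\<not> robust_split a b (Suc k) x (Suc y)"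
    by auto
  \<comment> \<open>Division with remainder supplies the witnesses for the Jump Condition.\<close>
  define qa ra qb rb where q: "qa = x div a" "ra = x mod a" "qb = y div b" "rb = y mod b"
  have x: "x = qa * a + ra" "ra < a" and y: "y = qb * b + rb" "rb < b"
    using assms by (auto simp: q)
  \<comment> \<open>Adding to the first part raises the quantity
    \<open>x + balanced_pair b y\<close> above \<open>Suc k\<close>, so the other one must fail: it
    was exactly \<open>Suc k\<close> and did not grow.\<close>
  have "y + balanced_pair a (Suc x) = Suc k" "balanced_pair a (Suc x) = balanced_pair a x"
    using no(1) assms(3) balanced_pair_mono[of x "Suc x" a]
    by (auto simp: robust_split_def)
  moreover have "x + balanced_pair b (Suc y) = Suc k" "balanced_pair b (Suc y) = balanced_pair b y"
    using no(2) assms(3) balanced_pair_mono[of y "Suc y" b]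
    by (auto simp: robust_split_def)
  moreover have "balanced_pair a (Suc x) = balanced_pair a x + (if ra + 3 \<le> a then 0 else 1)"
    using balanced_pair_Suc[OF assms(1) x(2), of qa] x(1) by simp
  moreover have "balanced_pair b (Suc y) = balanced_pair b y + (if rb + 3 \<le> b then 0 else 1)"
    using balanced_pair_Suc[OF assms(2) y(2), of qb] y(1) by simp
  moreover have "balanced_pair a x = 2 * qa + (if ra + 1 = a then 1 else 0)"
    using balanced_pair_decomp[OF x(2), of qa] x(1) by simp
  moreover have "balanced_pair b y = 2 * qb + (if rb + 1 = b then 1 else 0)"
    using balanced_pair_decomp[OF y(2), of qb] y(1) by simp
  \<comment> \<open>Absence of growth bounds the remainders, which also excludes the exceptional
    \<open>+ 1\<close> in the balanced values.\<close>
  ultimately have "ra + 3 \<le> a" "rb + 3 \<le> b" "y + 2 * qa = Suc k" "x + 2 * qb = Suc k"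
    by (auto split: if_splits)
  then have "jump_condition a b k (x + y)"
    unfolding jump_condition_def using x y
    by (intro exI[of _ qa] exI[of _ ra] exI[of _ qb] exI[of _ rb]) auto
  then show False using assms(4) by simp
qed

theorem theorem4:
  fixes a b :: nat and G :: "('v, 'e) pre_digraph"
  assumes "3 \<le> a" and "a \<le> b"
    and "complete_bipartite_digraph a b G"
  shows "\<forall>k. rpd_number G (k + 1) =
    (if jump_condition a b k (rpd_number G k) then rpd_number G k + 2 else rpd_number G k + 1)"
proof
  fix k
  let ?p = "rpd_number G"
  have b: "3 \<le> b" using assms by simp
  obtain U V where UV: "verts G = U \<union> V" "U \<inter> V = {}" "card U = a" "card V = b"
      "arcs_ends G = U \<times> V \<union> V \<times> U"
    using assms(3) unfolding complete_bipartite_digraph_def by blast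
  interpret graph G using assms(3) by (simp add: complete_bipartite_digraph_def)
  \<comment> \<open>Positive cardinality yields finiteness of the parts, as \<open>card\<close> is 0
    on infinite sets.\<close>
  interpret bipartite_parts G U V
    using UV assms(1) b by unfold_locales (auto intro: card_ge_0_finite)
  have ex: "(\<exists>S. rpds G k S \<and> size S = n) \<longleftrightarrow> (\<exists>x y. x + y = n \<and> robust_split a b k x y)" for k n
    using ex_rpds_iff by (simp add: robust_split_def UV)
  have attained: "\<exists>x y. x + y = ?p k \<and> robust_split a b k x y" for k
    using rpd_number_attained[of k] UV b unfolding ex by fastforce
  have least: "?p k \<le> x + y" if "robust_split a b k x y" for k x y
    unfolding rpd_number_def ex using that by (intro Least_le) blast
  obtain x y where xy: "x + y = ?p k" "robust_split a b k x y" using attained by blast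
  \<comment> \<open>With \<open>lower\<close> this leaves two values for \<open>?p (Suc k)\<close>;
    the Jump Condition decides whether the smaller one is attained.\<close>
  have upper: "?p (Suc k) \<le> ?p k + 2"
    using least[OF robust_split_Suc_Suc[OF xy(2)]] xy(1) by simp
  obtain x' y' where xy': "x' + y' = ?p (Suc k)" "robust_split a b (Suc k) x' y'"
    using attained by blast
  have lower: "?p k + 1 \<le> ?p (Suc k)"
    using robust_split_Suc_pred[OF assms(1) b xy'(2)] least xy'(1) by fastforce
  show "?p (k + 1) = (if jump_condition a b k (?p k) then ?p k + 2 else ?p k + 1)"
  proof (cases "jump_condition a b k (?p k)")
    case True
    then have "?p (Suc k) \<noteq> Suc (?p k)"
      using no_robust_split_if_jump[OF assms(1) b True, of x' y'] xy' by auto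
    then show ?thesis using True upper lower by simp
  next
    case False
    then have "?p (Suc k) \<le> ?p k + 1"
      using ex_robust_split_if_not_jump[OF assms(1) b xy(2)] least xy(1) by fastforce
    then show ?thesis using False lower by simp
  qed
qed

end
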